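(* Let $f:R_1\rightarrow R_2$ be a surjective homomorphism of commutative rings with identity, $J$ an ideal of $R_2$, $M_1$ an $R_1$-module, $M_2$ an $R_2$-module (regarded as an $R_1$-module via $f$), and $\varphi:M_1\rightarrow M_2$ a surjective $R_1$-module homomorphism. Consider the $(R_1\Join^f J)$-module $M_1\Join^{\varphi}JM_2$ and let $N_2$ be a submodule of $M_2$. Then: (1) $\overline{N_2}^{\varphi}$ is a primary submodule of $M_1\Join^{\varphi}JM_2$ if and only if $N_2$ is a primary submodule of $M_2$. (2) $\overline{N_2}^{\varphi}$ is a weakly primary submodule of $M_1\Join^{\varphi}JM_2$ if and only if $N_2$ is a weakly primary submodule of $M_2$ and the following holds: for all $r_1\in R_1$, $m_1\in M_1$, $m_2\in JM_2$, $j\in J$ with $(f(r_1)+j)(\varphi(m_1)+m_2)=0$ but $f(r_1)+j\notin\sqrt{(N_2:_{R_2}M_2)}$ and $\varphi(m_1)+m_2\notin N_2$, one has $r_1m_1=0$.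
   Context: All modules are unital. $(N:_R M)=\{r\in R: rM\subseteq N\}$. $R_1\Join^f J=\{(r,f(r)+j): r\in R_1, j\in J\}$ is a subring of $R_1\times R_2$. $M_1\Join^{\varphi}JM_2=\{(m_1,\varphi(m_1)+m_2): m_1\in M_1, m_2\in JM_2\}$ is an $(R_1\Join^f J)$-module with $(r,f(r)+j)(m_1,\varphi(m_1)+m_2)=(rm_1,\varphi(rm_1)+f(r)m_2+j\varphi(m_1)+jm_2)$. $\overline{N_2}^{\varphi}=\{(m_1,\varphi(m_1)+m_2)\in M_1\Join^{\varphi}JM_2: \varphi(m_1)+m_2\in N_2\}$ is a submodule of it. A proper submodule $N$ of an $R$-module $M$ is primary (resp. weakly primary) if for all $a\in R$, $m\in M$, $am\in N$ (resp. $0\neq am\in N$) implies $a\in\sqrt{(N:_R M)}$ or $m\in N$. *)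

theory Defs
  imports "HOL-Algebra.Algebra"
begin

section \<open>Residuals, radicals, and (weakly) primary submodules\<close>

definition residual ::
    "'b set \<Rightarrow> ('a, 'm) ring_scheme \<Rightarrow> ('a, 'b, 'n) module_scheme \<Rightarrow> 'a set"
  where "residual N R M = {r \<in> carrier R. \<forall>x \<in> carrier M. r \<odot>\<^bsub>M\<^esub> x \<in> N}"

definition radical :: "('a, 'm) ring_scheme \<Rightarrow> 'a set \<Rightarrow> 'a set"
  where "radical R I = {r \<in> carrier R. \<exists>n::nat. n > 0 \<and> r [^]\<^bsub>R\<^esub> n \<in> I}"

definition primary_submodule ::
    "'b set \<Rightarrow> ('a, 'm) ring_scheme \<Rightarrow> ('a, 'b, 'n) module_scheme \<Rightarrow> bool"
  where "primary_submodule N R M \<longleftrightarrow>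
    submodule N R M \<and> N \<noteq> carrier M \<and>
    (\<forall>a \<in> carrier R. \<forall>x \<in> carrier M.
       a \<odot>\<^bsub>M\<^esub> x \<in> N \<longrightarrow> a \<in> radical R (residual N R M) \<or> x \<in> N)"

definition weakly_primary_submodule ::
    "'b set \<Rightarrow> ('a, 'm) ring_scheme \<Rightarrow> ('a, 'b, 'n) module_scheme \<Rightarrow> bool"
  where "weakly_primary_submodule N R M \<longleftrightarrow>
    submodule N R M \<and> N \<noteq> carrier M \<and>
    (\<forall>a \<in> carrier R. \<forall>x \<in> carrier M.
       a \<odot>\<^bsub>M\<^esub> x \<in> N \<and> a \<odot>\<^bsub>M\<^esub> x \<noteq> \<zero>\<^bsub>M\<^esub> \<longrightarrow>
       a \<in> radical R (residual N R M) \<or> x \<in> N)"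


section \<open>Module homomorphisms and restriction of scalars\<close>

definition mod_hom ::
    "('a, 'm) ring_scheme \<Rightarrow> ('a, 'b, 'n) module_scheme \<Rightarrow> ('a, 'c, 'k) module_scheme
      \<Rightarrow> ('b \<Rightarrow> 'c) set"
  where "mod_hom R M N =
    {h \<in> carrier M \<rightarrow> carrier N.
       (\<forall>x \<in> carrier M. \<forall>y \<in> carrier M. h (x \<oplus>\<^bsub>M\<^esub> y) = h x \<oplus>\<^bsub>N\<^esub> h y) \<and>
       (\<forall>r \<in> carrier R. \<forall>x \<in> carrier M. h (r \<odot>\<^bsub>M\<^esub> x) = r \<odot>\<^bsub>N\<^esub> h x)}"

definition restrict_scalars :: "('a \<Rightarrow> 'c) \<Rightarrow> ('c, 'b, 'n) module_scheme \<Rightarrow> ('a, 'b) module"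
  where "restrict_scalars f M =
    \<lparr>carrier = carrier M, monoid.mult = monoid.mult M, one = one M, ring.zero = ring.zero M, add = add M,
     smult = (\<lambda>r x. f r \<odot>\<^bsub>M\<^esub> x)\<rparr>"


section \<open>Amalgamation of a ring along an ideal, and of modules\<close>

definition amalg_ring ::
    "('a, 'm) ring_scheme \<Rightarrow> ('b, 'n) ring_scheme \<Rightarrow> ('a \<Rightarrow> 'b) \<Rightarrow> 'b set \<Rightarrow> ('a \<times> 'b) ring"
  where "amalg_ring R1 R2 f J =
    (RDirProd R1 R2)\<lparr>carrier := {(r, f r \<oplus>\<^bsub>R2\<^esub> j) | r j. r \<in> carrier R1 \<and> j \<in> J}\<rparr>"

text \<open>The submodule \<open>J M\<close>: all finite sums of products \<open>j m\<close>.\<close>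

definition ideal_mult :: "'a set \<Rightarrow> ('a, 'b, 'n) module_scheme \<Rightarrow> 'b set"
  where "ideal_mult J M =
    {(\<Oplus>\<^bsub>M\<^esub> i \<in> {..<n}. a i \<odot>\<^bsub>M\<^esub> x i) | (n::nat) a x.
       a \<in> {..<n} \<rightarrow> J \<and> x \<in> {..<n} \<rightarrow> carrier M}"

text \<open>An element \<open>(r, s)\<close> of the amalgamated ring determines \<open>j = s - f r\<close>, and an element
  \<open>(x, y)\<close> of the amalgamated module determines \<open>m = y - \<phi> x\<close>; the scalar product is
  \<open>(r x, \<phi> (r x) + f r m + j \<phi> x + j m)\<close>. See \<open>amalg_module_smult\<close> below.
  The fields \<open>mult\<close> and \<open>one\<close>, inherited from the ring record, play no role in a module.\<close>

definition amalg_module ::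
    "('a, 'c, 'm) module_scheme \<Rightarrow> ('b, 'm2) ring_scheme \<Rightarrow> ('b, 'd, 'n) module_scheme
      \<Rightarrow> ('a \<Rightarrow> 'b) \<Rightarrow> ('c \<Rightarrow> 'd) \<Rightarrow> 'b set \<Rightarrow> ('a \<times> 'b, 'c \<times> 'd) module"
  where "amalg_module M1 R2 M2 f \<phi> J =
    \<lparr>carrier = {(x, \<phi> x \<oplus>\<^bsub>M2\<^esub> m) | x m. x \<in> carrier M1 \<and> m \<in> ideal_mult J M2},
     monoid.mult = undefined, one = undefined,
     ring.zero = (\<zero>\<^bsub>M1\<^esub>, \<zero>\<^bsub>M2\<^esub>),
     add = (\<lambda>(x, y) (x', y'). (x \<oplus>\<^bsub>M1\<^esub> x', y \<oplus>\<^bsub>M2\<^esub> y')),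
     smult = (\<lambda>(r, s) (x, y).
       let j = s \<ominus>\<^bsub>R2\<^esub> f r; m = y \<ominus>\<^bsub>M2\<^esub> \<phi> x in
       (r \<odot>\<^bsub>M1\<^esub> x,
        \<phi> (r \<odot>\<^bsub>M1\<^esub> x) \<oplus>\<^bsub>M2\<^esub> f r \<odot>\<^bsub>M2\<^esub> m \<oplus>\<^bsub>M2\<^esub> j \<odot>\<^bsub>M2\<^esub> \<phi> x \<oplus>\<^bsub>M2\<^esub> j \<odot>\<^bsub>M2\<^esub> m))\<rparr>"

definition amalg_sub ::
    "('a, 'c, 'm) module_scheme \<Rightarrow> ('b, 'd, 'n) module_scheme \<Rightarrow> ('c \<Rightarrow> 'd) \<Rightarrow> 'b set
      \<Rightarrow> 'd set \<Rightarrow> ('c \<times> 'd) set"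
  where "amalg_sub M1 M2 \<phi> J N =
    {(x, \<phi> x \<oplus>\<^bsub>M2\<^esub> m) | x m.
       x \<in> carrier M1 \<and> m \<in> ideal_mult J M2 \<and> \<phi> x \<oplus>\<^bsub>M2\<^esub> m \<in> N}"


section \<open>Well-definedness of the amalgamated structures\<close>

lemma ideal_mult_submodule:
  assumes "module R M" and "ideal J R"
  shows "submodule (ideal_mult J M) R M"
proof -
  interpret module R M by fact
  interpret J: ideal J R by fact
  have JR: "j \<in> carrier R" if "j \<in> J" for j using that J.Icarr by blast
  have cl: "(\<lambda>i. a i \<odot>\<^bsub>M\<^esub> x i) \<in> {..<n} \<rightarrow> carrier M"
    if "a \<in> {..<n} \<rightarrow> J" "x \<in> {..<n} \<rightarrow> carrier M" for a x and n :: nat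
    using that JR by (auto simp: Pi_iff)
  have smul: "r \<odot>\<^bsub>M\<^esub> u \<in> ideal_mult J M" if r: "r \<in> carrier R" and u: "u \<in> ideal_mult J M" for r u
  proof -
    from u obtain n :: nat and a x where u: "u = (\<Oplus>\<^bsub>M\<^esub> i \<in> {..<n}. a i \<odot>\<^bsub>M\<^esub> x i)"
      and a: "a \<in> {..<n} \<rightarrow> J" and x: "x \<in> {..<n} \<rightarrow> carrier M"
      unfolding ideal_mult_def by blast
    have "r \<odot>\<^bsub>M\<^esub> u = (\<Oplus>\<^bsub>M\<^esub> i \<in> {..<n}. r \<odot>\<^bsub>M\<^esub> (a i \<odot>\<^bsub>M\<^esub> x i))"
      unfolding u by (rule finsum_smult_ldistr) (use r cl[OF a x] in auto)
    also have "\<dots> = (\<Oplus>\<^bsub>M\<^esub> i \<in> {..<n}. (r \<otimes>\<^bsub>R\<^esub> a i) \<odot>\<^bsub>M\<^esub> x i)"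
    proof (rule M.finsum_cong')
      show "(\<lambda>i. (r \<otimes>\<^bsub>R\<^esub> a i) \<odot>\<^bsub>M\<^esub> x i) \<in> {..<n} \<rightarrow> carrier M"
        using r a x JR by (auto simp: Pi_iff)
    qed (use r a x JR in \<open>auto simp: Pi_iff smult_assoc1\<close>)
    finally show ?thesis
      unfolding ideal_mult_def using r a x J.I_l_closed
      by (intro CollectI exI[of _ n] exI[of _ "\<lambda>i. r \<otimes>\<^bsub>R\<^esub> a i"] exI[of _ x]) (auto simp: Pi_iff)
  qed
  have sub: "ideal_mult J M \<subseteq> carrier M"
    unfolding ideal_mult_def using M.finsum_closed[OF cl] by blast
  show ?thesis
  proof (rule submoduleI)
    show "ideal_mult J M \<subseteq> carrier M" by (fact sub)
    show "\<zero>\<^bsub>M\<^esub> \<in> ideal_mult J M" unfolding ideal_mult_def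
      by (intro CollectI exI[of _ 0]) auto
    show "\<ominus>\<^bsub>M\<^esub> u \<in> ideal_mult J M" if "u \<in> ideal_mult J M" for u
      using smul[of "\<ominus>\<^bsub>R\<^esub> \<one>\<^bsub>R\<^esub>" u] that sub smult_l_minus[of "\<one>\<^bsub>R\<^esub>" u] by auto
    show "r \<odot>\<^bsub>M\<^esub> u \<in> ideal_mult J M" if "r \<in> carrier R" "u \<in> ideal_mult J M" for r u
      using smul that by blast
  next
    fix u v assume u: "u \<in> ideal_mult J M" and v: "v \<in> ideal_mult J M"
    from u obtain n :: nat and a x where u: "u = (\<Oplus>\<^bsub>M\<^esub> i \<in> {..<n}. a i \<odot>\<^bsub>M\<^esub> x i)"
      and a: "a \<in> {..<n} \<rightarrow> J" and x: "x \<in> {..<n} \<rightarrow> carrier M"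
      unfolding ideal_mult_def by blast
    from v obtain k :: nat and b y where v: "v = (\<Oplus>\<^bsub>M\<^esub> i \<in> {..<k}. b i \<odot>\<^bsub>M\<^esub> y i)"
      and b: "b \<in> {..<k} \<rightarrow> J" and y: "y \<in> {..<k} \<rightarrow> carrier M"
      unfolding ideal_mult_def by blast
    define c where "c = (\<lambda>i. if i < n then a i else b (i - n))"
    define z where "z = (\<lambda>i. if i < n then x i else y (i - n))"
    have c: "c \<in> {..<n+l} \<rightarrow> J" and z: "z \<in> {..<n+l} \<rightarrow> carrier M" if "l \<le> k" for l
      using that a b x y by (auto simp: c_def z_def Pi_iff)
    have "(\<Oplus>\<^bsub>M\<^esub> i \<in> {..<n+l}. c i \<odot>\<^bsub>M\<^esub> z i) = u \<oplus>\<^bsub>M\<^esub> (\<Oplus>\<^bsub>M\<^esub> i \<in> {..<l}. b i \<odot>\<^bsub>M\<^esub> y i)" if "l \<le> k" for l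
      using that
    proof (induction l)
      case 0
      have "(\<Oplus>\<^bsub>M\<^esub> i \<in> {..<n}. c i \<odot>\<^bsub>M\<^esub> z i) = u"
        unfolding u by (rule M.finsum_cong') (use cl[OF a x] in \<open>auto simp: c_def z_def\<close>)
      moreover have "u \<in> carrier M" unfolding u by (intro M.finsum_closed cl a x)
      ultimately show ?case by simp
    next
      case (Suc l)
      have uc: "u \<in> carrier M" unfolding u by (intro M.finsum_closed cl a x)
      have cc: "(\<lambda>i. c i \<odot>\<^bsub>M\<^esub> z i) \<in> {..<n+l} \<rightarrow> carrier M"
        using cl[OF c[of l] z[of l]] Suc.prems by simp
      have bc: "(\<lambda>i. b i \<odot>\<^bsub>M\<^esub> y i) \<in> {..<l} \<rightarrow> carrier M"
        using cl[OF b y] Suc.prems by (auto simp: Pi_iff)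
      have t: "c (n+l) \<odot>\<^bsub>M\<^esub> z (n+l) = b l \<odot>\<^bsub>M\<^esub> y l" by (simp add: c_def z_def)
      have tc: "b l \<odot>\<^bsub>M\<^esub> y l \<in> carrier M" using cl[OF b y] Suc.prems by (auto simp: Pi_iff)
      show ?case using Suc cc bc uc tc t
        by (simp add: lessThan_Suc M.finsum_insert M.a_lcomm M.finsum_closed)
    qed
    from this[of k] have "u \<oplus>\<^bsub>M\<^esub> v = (\<Oplus>\<^bsub>M\<^esub> i \<in> {..<n+k}. c i \<odot>\<^bsub>M\<^esub> z i)" by (simp add: v)
    then show "u \<oplus>\<^bsub>M\<^esub> v \<in> ideal_mult J M"
      unfolding ideal_mult_def using c[of k] z[of k] by blast
  qed
qed

lemma amalg_module_smult_pair:
  assumes "cring R1" "cring R2" "f \<in> ring_hom R1 R2" "module R1 M1" "module R2 M2"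
    "\<phi> \<in> mod_hom R1 M1 (restrict_scalars f M2)"
    "r \<in> carrier R1" "s \<in> carrier R2" "x \<in> carrier M1" "y \<in> carrier M2"
  shows "(r, s) \<odot>\<^bsub>amalg_module M1 R2 M2 f \<phi> J\<^esub> (x, y) = (r \<odot>\<^bsub>M1\<^esub> x, s \<odot>\<^bsub>M2\<^esub> y)"
proof -
  interpret R1: cring R1 by fact
  interpret M1: module R1 M1 by fact
  interpret M2: module R2 M2 by fact
  have fr: "f r \<in> carrier R2" using assms by (auto simp: ring_hom_def)
  have px: "\<phi> x \<in> carrier M2" and ph: "\<phi> (r \<odot>\<^bsub>M1\<^esub> x) = f r \<odot>\<^bsub>M2\<^esub> \<phi> x"
    using assms by (auto simp: mod_hom_def restrict_scalars_def)
  define j where "j = s \<ominus>\<^bsub>R2\<^esub> f r"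
  define m where "m = y \<ominus>\<^bsub>M2\<^esub> \<phi> x"
  have j: "j \<in> carrier R2" and m: "m \<in> carrier M2" using assms fr px by (auto simp: j_def m_def)
  have s: "s = f r \<oplus>\<^bsub>R2\<^esub> j"
    using assms fr by (simp add: j_def a_minus_def M2.R.a_lcomm M2.R.r_neg)
  have y: "y = \<phi> x \<oplus>\<^bsub>M2\<^esub> m"
    using assms px by (simp add: m_def a_minus_def M2.M.a_lcomm M2.M.r_neg)
  have "s \<odot>\<^bsub>M2\<^esub> y = f r \<odot>\<^bsub>M2\<^esub> \<phi> x \<oplus>\<^bsub>M2\<^esub> f r \<odot>\<^bsub>M2\<^esub> m \<oplus>\<^bsub>M2\<^esub> j \<odot>\<^bsub>M2\<^esub> \<phi> x \<oplus>\<^bsub>M2\<^esub> j \<odot>\<^bsub>M2\<^esub> m"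
    unfolding s y using fr j px m by (simp add: M2.smult_l_distr M2.smult_r_distr M2.M.a_ac)
  then show ?thesis by (simp add: amalg_module_def Let_def ph flip: j_def m_def)
qed

lemma amalg_module_smult:
  assumes "cring R1" "cring R2" "f \<in> ring_hom R1 R2" "ideal J R2" "module R1 M1" "module R2 M2"
    "\<phi> \<in> mod_hom R1 M1 (restrict_scalars f M2)"
    "r \<in> carrier R1" "j \<in> J" "x \<in> carrier M1" "m \<in> ideal_mult J M2"
  shows "(r, f r \<oplus>\<^bsub>R2\<^esub> j) \<odot>\<^bsub>amalg_module M1 R2 M2 f \<phi> J\<^esub> (x, \<phi> x \<oplus>\<^bsub>M2\<^esub> m) =
    (r \<odot>\<^bsub>M1\<^esub> x,
     \<phi> (r \<odot>\<^bsub>M1\<^esub> x) \<oplus>\<^bsub>M2\<^esub> f r \<odot>\<^bsub>M2\<^esub> m \<oplus>\<^bsub>M2\<^esub> j \<odot>\<^bsub>M2\<^esub> \<phi> x \<oplus>\<^bsub>M2\<^esub> j \<odot>\<^bsub>M2\<^esub> m)"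
proof -
  interpret M2: module R2 M2 by fact
  interpret J: ideal J R2 by fact
  have fr: "f r \<in> carrier R2" and j: "j \<in> carrier R2"
    using assms J.Icarr by (auto simp: ring_hom_def)
  have px: "\<phi> x \<in> carrier M2"
    using assms by (auto simp: mod_hom_def restrict_scalars_def)
  have m: "m \<in> carrier M2"
    using M2.submoduleE(1)[OF ideal_mult_submodule[OF assms(6,4)]] assms by auto
  have "(f r \<oplus>\<^bsub>R2\<^esub> j) \<ominus>\<^bsub>R2\<^esub> f r = j"
    using fr j by (metis M2.R.a_comm M2.R.minus_closed M2.R.minus_eq M2.R.r_neg2 M2.R.a_assoc M2.R.a_inv_closed M2.R.r_neg M2.R.r_zero)
  moreover have "(\<phi> x \<oplus>\<^bsub>M2\<^esub> m) \<ominus>\<^bsub>M2\<^esub> \<phi> x = m"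
    using px m by (metis M2.M.a_comm M2.M.minus_eq M2.M.a_assoc M2.M.a_inv_closed M2.M.r_neg M2.M.r_zero)
  ultimately show ?thesis by (simp add: amalg_module_def Let_def)
qed

lemma amalg_ring_cring:
  assumes "cring R1" "cring R2" "f \<in> ring_hom R1 R2" "ideal J R2"
  shows "cring (amalg_ring R1 R2 f J)"
proof -
  interpret R1: cring R1 by fact
  interpret R2: cring R2 by fact
  interpret J: ideal J R2 by fact
  interpret h: ring_hom_ring R1 R2 f
    by (intro ring_hom_ringI2 R1.ring_axioms R2.ring_axioms assms(3))
  let ?P = "RDirProd R1 R2"
  let ?A = "{(r, f r \<oplus>\<^bsub>R2\<^esub> j) | r j. r \<in> carrier R1 \<and> j \<in> J}"
  interpret P: ring ?P by (intro RDirProd_ring R1.ring_axioms R2.ring_axioms)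
  have sel: "\<one>\<^bsub>?P\<^esub> = (\<one>\<^bsub>R1\<^esub>, \<one>\<^bsub>R2\<^esub>)" "\<zero>\<^bsub>?P\<^esub> = (\<zero>\<^bsub>R1\<^esub>, \<zero>\<^bsub>R2\<^esub>)"
    "\<And>a b c d. (a, b) \<oplus>\<^bsub>?P\<^esub> (c, d) = (a \<oplus>\<^bsub>R1\<^esub> c, b \<oplus>\<^bsub>R2\<^esub> d)"
    "\<And>a b c d. (a, b) \<otimes>\<^bsub>?P\<^esub> (c, d) = (a \<otimes>\<^bsub>R1\<^esub> c, b \<otimes>\<^bsub>R2\<^esub> d)"
    by (auto simp: RDirProd_def DirProd_def monoid.defs)
  have car: "carrier ?P = carrier R1 \<times> carrier R2" by (rule RDirProd_carrier)
  have mem: "(r, s) \<in> ?A" if "r \<in> carrier R1" "j \<in> J" "s = f r \<oplus>\<^bsub>R2\<^esub> j" for r s j using that by blast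
  have sub: "?A \<subseteq> carrier ?P" using J.Icarr by (auto simp: car)
  have "subcring ?A ?P"
  proof (rule P.subcringI[OF P.subringI])
    show "?A \<subseteq> carrier ?P" by (fact sub)
    show "\<one>\<^bsub>?P\<^esub> \<in> ?A" unfolding sel by (rule mem[of _ "\<zero>\<^bsub>R2\<^esub>"]) auto
  next
    fix u assume "u \<in> ?A"
    then obtain r j where u: "u = (r, f r \<oplus>\<^bsub>R2\<^esub> j)" and r: "r \<in> carrier R1" and j: "j \<in> J" by blast
    have jc: "j \<in> carrier R2" using j by (rule J.Icarr)
    have "\<ominus>\<^bsub>?P\<^esub> u = (\<ominus>\<^bsub>R1\<^esub> r, \<ominus>\<^bsub>R2\<^esub> (f r \<oplus>\<^bsub>R2\<^esub> j))"
      by (rule P.minus_equality) (use r jc in \<open>auto simp: u sel car R1.l_neg R2.l_neg\<close>)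
    also have "\<dots> \<in> ?A"
      by (rule mem[of _ "\<ominus>\<^bsub>R2\<^esub> j"]) (use r j jc in \<open>auto simp: R2.minus_add\<close>)
    finally show "\<ominus>\<^bsub>?P\<^esub> u \<in> ?A" .
  next
    fix u v assume "u \<in> ?A" "v \<in> ?A"
    then obtain r j r' j' where u: "u = (r, f r \<oplus>\<^bsub>R2\<^esub> j)" and r: "r \<in> carrier R1" and j: "j \<in> J"
      and v: "v = (r', f r' \<oplus>\<^bsub>R2\<^esub> j')" and r': "r' \<in> carrier R1" and j': "j' \<in> J" by blast
    have jc: "j \<in> carrier R2" "j' \<in> carrier R2" using j j' by (auto intro: J.Icarr)
    show "u \<oplus>\<^bsub>?P\<^esub> v \<in> ?A" unfolding u v sel
      by (rule mem[of _ "j \<oplus>\<^bsub>R2\<^esub> j'"]) (use r r' j j' jc in \<open>auto simp: R2.a_ac\<close>)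
    show "u \<otimes>\<^bsub>?P\<^esub> v \<in> ?A" unfolding u v sel
      by (rule mem[of _ "f r \<otimes>\<^bsub>R2\<^esub> j' \<oplus>\<^bsub>R2\<^esub> j \<otimes>\<^bsub>R2\<^esub> f r' \<oplus>\<^bsub>R2\<^esub> j \<otimes>\<^bsub>R2\<^esub> j'"])
        (use r r' j j' jc in \<open>auto simp: R2.l_distr R2.r_distr R2.a_ac J.I_l_closed J.I_r_closed\<close>)
  next
    fix u v assume "u \<in> ?A" "v \<in> ?A"
    then show "u \<otimes>\<^bsub>?P\<^esub> v = v \<otimes>\<^bsub>?P\<^esub> u"
      using sub by (cases u, cases v) (auto simp: sel car R1.m_comm R2.m_comm dest!: J.Icarr)
  qed
  then show ?thesis unfolding amalg_ring_def using P.subcring_iff[OF sub] by simp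
qed

lemma amalg_module_module:
  assumes "cring R1" "cring R2" "f \<in> ring_hom R1 R2" "ideal J R2" "module R1 M1" "module R2 M2"
    "\<phi> \<in> mod_hom R1 M1 (restrict_scalars f M2)"
  shows "module (amalg_ring R1 R2 f J) (amalg_module M1 R2 M2 f \<phi> J)"
proof -
  interpret R1: cring R1 by fact
  interpret R2: cring R2 by fact
  interpret J: ideal J R2 by fact
  interpret M1: module R1 M1 by fact
  interpret M2: module R2 M2 by fact
  interpret h: ring_hom_ring R1 R2 f
    by (intro ring_hom_ringI2 R1.ring_axioms R2.ring_axioms assms(3))
  let ?R = "amalg_ring R1 R2 f J" and ?M = "amalg_module M1 R2 M2 f \<phi> J"
  note JM = M2.submoduleE[OF ideal_mult_submodule[OF assms(6,4)]]
  have JMc: "m \<in> carrier M2" if "m \<in> ideal_mult J M2" for m using that JM(1) by blast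
  have phc: "\<phi> x \<in> carrier M2" if "x \<in> carrier M1" for x
    using that assms(7) by (auto simp: mod_hom_def restrict_scalars_def)
  have pha: "\<phi> (x \<oplus>\<^bsub>M1\<^esub> y) = \<phi> x \<oplus>\<^bsub>M2\<^esub> \<phi> y"
    and phs: "r \<in> carrier R1 \<Longrightarrow> \<phi> (r \<odot>\<^bsub>M1\<^esub> x) = f r \<odot>\<^bsub>M2\<^esub> \<phi> x"
    if "x \<in> carrier M1" "y \<in> carrier M1" for x y r
    using that assms(7) by (auto simp: mod_hom_def restrict_scalars_def)
  have carR: "u \<in> carrier ?R \<longleftrightarrow> (\<exists>r j. u = (r, f r \<oplus>\<^bsub>R2\<^esub> j) \<and> r \<in> carrier R1 \<and> j \<in> J)" for u
    by (auto simp: amalg_ring_def)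
  have carM: "u \<in> carrier ?M \<longleftrightarrow> (\<exists>x m. u = (x, \<phi> x \<oplus>\<^bsub>M2\<^esub> m) \<and> x \<in> carrier M1 \<and> m \<in> ideal_mult J M2)" for u
    by (auto simp: amalg_module_def)
  have Rs: "\<exists>r s. u = (r, s) \<and> r \<in> carrier R1 \<and> s \<in> carrier R2" if "u \<in> carrier ?R" for u
    using that J.Icarr unfolding carR by fastforce
  have Ms: "\<exists>x y. u = (x, y) \<and> x \<in> carrier M1 \<and> y \<in> carrier M2" if "u \<in> carrier ?M" for u
    using that JMc phc unfolding carM by fastforce
  have opsR: "(a, b) \<oplus>\<^bsub>?R\<^esub> (c, d) = (a \<oplus>\<^bsub>R1\<^esub> c, b \<oplus>\<^bsub>R2\<^esub> d)"
    "(a, b) \<otimes>\<^bsub>?R\<^esub> (c, d) = (a \<otimes>\<^bsub>R1\<^esub> c, b \<otimes>\<^bsub>R2\<^esub> d)"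
    "\<one>\<^bsub>?R\<^esub> = (\<one>\<^bsub>R1\<^esub>, \<one>\<^bsub>R2\<^esub>)" for a b c d
    by (auto simp: amalg_ring_def RDirProd_def DirProd_def monoid.defs)
  have opsM: "(x, y) \<oplus>\<^bsub>?M\<^esub> (x', y') = (x \<oplus>\<^bsub>M1\<^esub> x', y \<oplus>\<^bsub>M2\<^esub> y')" "\<zero>\<^bsub>?M\<^esub> = (\<zero>\<^bsub>M1\<^esub>, \<zero>\<^bsub>M2\<^esub>)" for x y x' y'
    by (auto simp: amalg_module_def)
  note sm = amalg_module_smult_pair[OF assms(1-3,5-7), of _ _ _ _ J]
  have memM: "(x, y) \<in> carrier ?M" if "x \<in> carrier M1" "m \<in> ideal_mult J M2" "y = \<phi> x \<oplus>\<^bsub>M2\<^esub> m" for x y m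
    using that unfolding carM by blast
  have inJM: "j \<odot>\<^bsub>M2\<^esub> z \<in> ideal_mult J M2" if "j \<in> J" "z \<in> carrier M2" for j z
    unfolding ideal_mult_def
    by (intro CollectI exI[of _ "1::nat"] exI[of _ "\<lambda>_. j"] exI[of _ "\<lambda>_. z"])
       (use that J.Icarr in \<open>auto simp: lessThan_Suc\<close>)
  have addM: "u \<oplus>\<^bsub>?M\<^esub> v \<in> carrier ?M" if uv: "u \<in> carrier ?M" "v \<in> carrier ?M" for u v
  proof -
    from uv obtain x m x' m' where *: "u = (x, \<phi> x \<oplus>\<^bsub>M2\<^esub> m)" "x \<in> carrier M1" "m \<in> ideal_mult J M2"
      "v = (x', \<phi> x' \<oplus>\<^bsub>M2\<^esub> m')" "x' \<in> carrier M1" "m' \<in> ideal_mult J M2" unfolding carM by blast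
    show ?thesis unfolding * opsM
      by (rule memM[of _ "m \<oplus>\<^bsub>M2\<^esub> m'"]) (use * JMc phc JM in \<open>auto simp: pha M2.M.a_ac\<close>)
  qed
  have smM: "u \<odot>\<^bsub>?M\<^esub> v \<in> carrier ?M" if uv: "u \<in> carrier ?R" "v \<in> carrier ?M" for u v
  proof -
    from uv obtain r j x m where *: "u = (r, f r \<oplus>\<^bsub>R2\<^esub> j)" "r \<in> carrier R1" "j \<in> J"
      "v = (x, \<phi> x \<oplus>\<^bsub>M2\<^esub> m)" "x \<in> carrier M1" "m \<in> ideal_mult J M2" unfolding carM carR by blast
    have c: "f r \<in> carrier R2" "j \<in> carrier R2" "\<phi> x \<in> carrier M2" "m \<in> carrier M2"
      using * J.Icarr JMc phc by auto
    have "u \<odot>\<^bsub>?M\<^esub> v = (r \<odot>\<^bsub>M1\<^esub> x, (f r \<oplus>\<^bsub>R2\<^esub> j) \<odot>\<^bsub>M2\<^esub> (\<phi> x \<oplus>\<^bsub>M2\<^esub> m))"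
      unfolding * by (rule sm) (use * c in auto)
    also have "\<dots> \<in> carrier ?M"
      by (rule memM[of _ "f r \<odot>\<^bsub>M2\<^esub> m \<oplus>\<^bsub>M2\<^esub> (j \<odot>\<^bsub>M2\<^esub> \<phi> x \<oplus>\<^bsub>M2\<^esub> j \<odot>\<^bsub>M2\<^esub> m)"])
         (use * c JM inJM in \<open>auto simp: phs M2.smult_l_distr M2.smult_r_distr M2.M.a_ac\<close>)
    finally show ?thesis .
  qed
  have negM: "\<exists>v\<in>carrier ?M. v \<oplus>\<^bsub>?M\<^esub> u = \<zero>\<^bsub>?M\<^esub>" if u: "u \<in> carrier ?M" for u
  proof -
    from u obtain x m where *: "u = (x, \<phi> x \<oplus>\<^bsub>M2\<^esub> m)" "x \<in> carrier M1" "m \<in> ideal_mult J M2"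
      unfolding carM by blast
    have c: "\<phi> x \<in> carrier M2" "m \<in> carrier M2" using * JMc phc by auto
    have "\<phi> (\<ominus>\<^bsub>M1\<^esub> x) = \<phi> ((\<ominus>\<^bsub>R1\<^esub> \<one>\<^bsub>R1\<^esub>) \<odot>\<^bsub>M1\<^esub> x)"
      using * by (simp add: M1.smult_l_minus)
    also have "\<dots> = \<ominus>\<^bsub>M2\<^esub> \<phi> x" using * c using phs[of x x "\<ominus>\<^bsub>R1\<^esub> \<one>\<^bsub>R1\<^esub>"] by (simp add: M2.smult_l_minus)
    finally have n: "\<phi> (\<ominus>\<^bsub>M1\<^esub> x) = \<ominus>\<^bsub>M2\<^esub> \<phi> x" .
    have "(\<ominus>\<^bsub>M1\<^esub> x, \<ominus>\<^bsub>M2\<^esub> (\<phi> x \<oplus>\<^bsub>M2\<^esub> m)) \<in> carrier ?M"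
      by (rule memM[of _ "\<ominus>\<^bsub>M2\<^esub> m"]) (use * c JM in \<open>auto simp: n M2.M.minus_add\<close>)
    then show ?thesis
      by (rule bexI[rotated]) (use * c in \<open>auto simp: opsM M1.M.l_neg M2.M.l_neg\<close>)
  qed
  have "\<phi> \<zero>\<^bsub>M1\<^esub> = \<phi> (\<zero>\<^bsub>R1\<^esub> \<odot>\<^bsub>M1\<^esub> \<zero>\<^bsub>M1\<^esub>)" by simp
  also have "\<dots> = \<zero>\<^bsub>M2\<^esub>" using phc phs[of "\<zero>\<^bsub>M1\<^esub>" "\<zero>\<^bsub>M1\<^esub>" "\<zero>\<^bsub>R1\<^esub>"] by simp
  finally have "\<phi> \<zero>\<^bsub>M1\<^esub> = \<zero>\<^bsub>M2\<^esub>" .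
  moreover have "\<zero>\<^bsub>M2\<^esub> \<in> ideal_mult J M2" using inJM[of "\<zero>\<^bsub>R2\<^esub>" "\<zero>\<^bsub>M2\<^esub>"] by simp
  ultimately have zM: "\<zero>\<^bsub>?M\<^esub> \<in> carrier ?M"
    unfolding opsM by (intro memM[of _ "\<zero>\<^bsub>M2\<^esub>"]) auto
  show ?thesis
  proof (rule moduleI)
    show "cring ?R" by (rule amalg_ring_cring[OF assms(1-4)])
    show "abelian_group ?M"
    proof (rule abelian_groupI)
      fix u v w assume "u \<in> carrier ?M" "v \<in> carrier ?M" "w \<in> carrier ?M"
      then show "u \<oplus>\<^bsub>?M\<^esub> v \<oplus>\<^bsub>?M\<^esub> w = u \<oplus>\<^bsub>?M\<^esub> (v \<oplus>\<^bsub>?M\<^esub> w)"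
        by (auto dest!: Ms simp: opsM M1.M.a_assoc M2.M.a_assoc)
    qed (use addM zM negM in \<open>auto dest!: Ms simp: opsM M1.M.a_comm M2.M.a_comm\<close>)
  qed (use smM in \<open>auto dest!: Ms Rs simp: opsM opsR sm M1.smult_l_distr M2.smult_l_distr
      M1.smult_r_distr M2.smult_r_distr M1.smult_assoc1 M2.smult_assoc1\<close>)
qed

end

theory Submission
  imports Defs
begin

text \<open>The second projections of \<open>R\<^sub>1 \<Join>\<^sup>f J\<close> and \<open>M\<^sub>1 \<Join>\<^sup>\<phi> J M\<^sub>2\<close> form a surjective ring homomorphism
  and a surjective semilinear map, and the amalgamated submodule is the preimage of \<open>N\<^sub>2\<close>. Radicals
  of residuals pull back along such a pair, hence so does primariness. Weak primariness pulls back
  up to the pairs \<open>(a, x)\<close> with \<open>p a \<odot> q x = \<zero>\<close> but \<open>a \<odot> x \<noteq> \<zero>\<close>; in the amalgamation these are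
  the pairs whose first components have a nonzero product.\<close>

lemma (in "module") submodule_zero_mem:
  assumes "submodule P R M"
  shows "\<zero>\<^bsub>M\<^esub> \<in> P"
  using submoduleE(1,2,4)[OF assms] smult_l_null by fastforce

text \<open>\<open>restrict_scalars p N\<close> turns \<open>N\<close> into an
  \<open>S\<close>-module along \<open>p\<close>, so semilinearity of \<open>q\<close> is ordinary
  linearity over \<open>S\<close>. The kernel of \<open>q\<close> may be nontrivial, hence nonzero
  products in \<open>M\<close> can become zero in \<open>N\<close>.\<close>

locale semilinear_surj =
  S: "module" S M + R: "module" R N
  for S :: "('s, 'k) ring_scheme" and M :: "('s, 'm, 'l) module_scheme"
    and R :: "('r, 'i) ring_scheme" and N :: "('r, 'n, 'j) module_scheme"
    and p :: "'s \<Rightarrow> 'r" and q :: "'m \<Rightarrow> 'n" +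
  assumes p_hom: "p \<in> ring_hom S R"
    and p_surj: "p ` carrier S = carrier R"
    and q_hom: "q \<in> mod_hom S M (restrict_scalars p N)"
    and q_surj: "q ` carrier M = carrier N"
begin

sublocale p: ring_hom_cring S R p
  by unfold_locales (rule p_hom)

lemma q_closed [simp]: "x \<in> carrier M \<Longrightarrow> q x \<in> carrier N"
  and q_add [simp]: "x \<in> carrier M \<Longrightarrow> y \<in> carrier M \<Longrightarrow> q (x \<oplus>\<^bsub>M\<^esub> y) = q x \<oplus>\<^bsub>N\<^esub> q y"
  and q_smult [simp]: "a \<in> carrier S \<Longrightarrow> x \<in> carrier M \<Longrightarrow> q (a \<odot>\<^bsub>M\<^esub> x) = p a \<odot>\<^bsub>N\<^esub> q x"
  using q_hom by (auto simp: mod_hom_def restrict_scalars_def)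

text \<open>Here and in \<open>ball_N\<close> surjectivity enters: statements about \<open>R\<close>
  and \<open>N\<close> are rephrased over \<open>S\<close> and \<open>M\<close>, where they can be
  compared with the preimage element by element.\<close>

lemma ball_R: "(\<forall>s \<in> carrier R. Q s) \<longleftrightarrow> (\<forall>a \<in> carrier S. Q (p a))"
  unfolding p_surj[symmetric] by blast

lemma ball_N: "(\<forall>y \<in> carrier N. Q y) \<longleftrightarrow> (\<forall>x \<in> carrier M. Q (q x))"
  unfolding q_surj[symmetric] by blast

text \<open>\<open>mod_hom\<close> speaks of sums and scalar multiples; zero and negatives are
  reached through the scalars 0 and -1.\<close>

lemma q_zero [simp]: "q \<zero>\<^bsub>M\<^esub> = \<zero>\<^bsub>N\<^esub>"
  using q_smult[of "\<zero>\<^bsub>S\<^esub>" "\<zero>\<^bsub>M\<^esub>"] by simp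

lemma q_minus [simp]: "x \<in> carrier M \<Longrightarrow> q (\<ominus>\<^bsub>M\<^esub> x) = \<ominus>\<^bsub>N\<^esub> q x"
  using q_smult[of "\<ominus>\<^bsub>S\<^esub> \<one>\<^bsub>S\<^esub>" x] by (simp add: S.smult_l_minus R.smult_l_minus)

definition preimage :: "'n set \<Rightarrow> 'm set"
  where "preimage P = {x \<in> carrier M. q x \<in> P}"

lemma preimage_submodule:
  assumes "submodule P R N"
  shows "submodule (preimage P) S M"
proof -
  note P = R.submoduleE[OF assms] R.submodule_zero_mem[OF assms]
  show ?thesis
    by (intro S.submoduleI) (use P in \<open>auto simp: preimage_def\<close>)
qed

text \<open>Properness transfers because, by surjectivity of \<open>q\<close>, an element of
  \<open>N\<close> outside \<open>P\<close> is hit by an element of \<open>M\<close> outside the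
  preimage.\<close>

lemma preimage_eq_carrier_iff:
  assumes "P \<subseteq> carrier N"
  shows "preimage P = carrier M \<longleftrightarrow> P = carrier N"
proof -
  have "preimage P = carrier M \<longleftrightarrow> (\<forall>y \<in> carrier N. y \<in> P)"
    unfolding ball_N by (auto simp: preimage_def)
  then show ?thesis
    using assms by auto
qed

lemma mem_radical_residual_preimage_iff:
  assumes "a \<in> carrier S"
  shows "a \<in> radical S (residual (preimage P) S M) \<longleftrightarrow> p a \<in> radical R (residual P R N)"
proof -
  \<comment> \<open>\<open>p\<close> commutes with powers, and the vectors \<open>q x\<close> that
    test membership in the residual exhaust \<open>N\<close>. The same exponent therefore witnesses
    both radicals.\<close>
  have "a [^]\<^bsub>S\<^esub> n \<in> residual (preimage P) S M \<longleftrightarrow> p a [^]\<^bsub>R\<^esub> n \<in> residual P R N" for n :: nat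
    using assms by (simp add: residual_def preimage_def ball_N)
  then show ?thesis
    using assms by (simp add: radical_def)
qed

text \<open>After pulling the quantifiers back to \<open>S\<close> and \<open>M\<close>, the two
  definitions agree clause by clause.\<close>

lemma primary_preimage_iff:
  assumes "submodule P R N"
  shows "primary_submodule (preimage P) S M \<longleftrightarrow> primary_submodule P R N"
proof -
  note P = preimage_submodule[OF assms] preimage_eq_carrier_iff[OF R.submoduleE(1)[OF assms]]
  show ?thesis
    unfolding primary_submodule_def ball_R ball_N
    using assms P mem_radical_residual_preimage_iff[of _ P]
    by (simp add: preimage_def)
qed

text \<open>The only mismatch is between a product being nonzero in \<open>M\<close> and its image
  being nonzero in \<open>N\<close>. The extra clause governs the products that are nonzero in
  \<open>M\<close> but lie in the kernel of \<open>q\<close>.\<close>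

lemma weakly_primary_preimage_iff:
  assumes "submodule P R N"
  shows "weakly_primary_submodule (preimage P) S M \<longleftrightarrow>
    weakly_primary_submodule P R N \<and>
    (\<forall>a \<in> carrier S. \<forall>x \<in> carrier M.
       p a \<odot>\<^bsub>N\<^esub> q x = \<zero>\<^bsub>N\<^esub> \<and> p a \<notin> radical R (residual P R N) \<and> q x \<notin> P \<longrightarrow>
       a \<odot>\<^bsub>M\<^esub> x = \<zero>\<^bsub>M\<^esub>)"
proof -
  note P = preimage_submodule[OF assms] preimage_eq_carrier_iff[OF R.submoduleE(1)[OF assms]]
  have zero: "\<zero>\<^bsub>N\<^esub> \<in> P"
    by (rule R.submodule_zero_mem[OF assms])
  have nonzero: "a \<odot>\<^bsub>M\<^esub> x \<noteq> \<zero>\<^bsub>M\<^esub>"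
    if "a \<in> carrier S" "x \<in> carrier M" "p a \<odot>\<^bsub>N\<^esub> q x \<noteq> \<zero>\<^bsub>N\<^esub>" for a x
    using that q_smult q_zero by metis
  have "weakly_primary_submodule (preimage P) S M \<longleftrightarrow> P \<noteq> carrier N \<and>
    (\<forall>a \<in> carrier S. \<forall>x \<in> carrier M. p a \<odot>\<^bsub>N\<^esub> q x \<in> P \<and> a \<odot>\<^bsub>M\<^esub> x \<noteq> \<zero>\<^bsub>M\<^esub> \<longrightarrow>
       p a \<in> radical R (residual P R N) \<or> q x \<in> P)"
    unfolding weakly_primary_submodule_def
    using P mem_radical_residual_preimage_iff[of _ P] by (simp add: preimage_def)
  moreover have "weakly_primary_submodule P R N \<longleftrightarrow> P \<noteq> carrier N \<and>
    (\<forall>a \<in> carrier S. \<forall>x \<in> carrier M. p a \<odot>\<^bsub>N\<^esub> q x \<in> P \<and> p a \<odot>\<^bsub>N\<^esub> q x \<noteq> \<zero>\<^bsub>N\<^esub> \<longrightarrow>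
       p a \<in> radical R (residual P R N) \<or> q x \<in> P)"
    unfolding weakly_primary_submodule_def ball_R ball_N
    using assms by simp
  \<comment> \<open>Case split on whether the image of the product is zero, with \<open>G\<close>
    for the conclusion of weak primariness. In the zero case membership in \<open>P\<close> is
    automatic by \<open>zero\<close>, and what remains is contraposed; in the other case
    \<open>nonzero\<close> makes the two premises equivalent.\<close>
  moreover have "(p a \<odot>\<^bsub>N\<^esub> q x \<in> P \<and> a \<odot>\<^bsub>M\<^esub> x \<noteq> \<zero>\<^bsub>M\<^esub> \<longrightarrow> G) \<longleftrightarrow>
      (p a \<odot>\<^bsub>N\<^esub> q x \<in> P \<and> p a \<odot>\<^bsub>N\<^esub> q x \<noteq> \<zero>\<^bsub>N\<^esub> \<longrightarrow> G) \<and>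
      (p a \<odot>\<^bsub>N\<^esub> q x = \<zero>\<^bsub>N\<^esub> \<and> \<not> G \<longrightarrow> a \<odot>\<^bsub>M\<^esub> x = \<zero>\<^bsub>M\<^esub>)"
    if "a \<in> carrier S" "x \<in> carrier M" for a x G
    using zero nonzero[OF that] by auto
  ultimately show ?thesis
    by (simp add: ball_conj_distrib)
qed

end

text \<open>Surjectivity of \<open>f\<close> and \<open>\<phi>\<close> is what makes the second projections surjective: \<open>s = f r\<close>
  is the image of \<open>(r, f r)\<close>.\<close>

lemma amalg_snd_semilinear_surj:
  assumes "cring R1" "cring R2" "f \<in> ring_hom R1 R2" "f ` carrier R1 = carrier R2" "ideal J R2"
    "module R1 M1" "module R2 M2"
    "\<phi> \<in> mod_hom R1 M1 (restrict_scalars f M2)" "\<phi> ` carrier M1 = carrier M2"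
  shows "semilinear_surj (amalg_ring R1 R2 f J) (amalg_module M1 R2 M2 f \<phi> J) R2 M2 snd snd"
proof -
  interpret J: ideal J R2 by fact
  interpret M1: "module" R1 M1 by fact
  interpret M2: "module" R2 M2 by fact
  let ?S = "amalg_ring R1 R2 f J" and ?M = "amalg_module M1 R2 M2 f \<phi> J"
  have carS: "carrier ?S = {(r, f r \<oplus>\<^bsub>R2\<^esub> j) | r j. r \<in> carrier R1 \<and> j \<in> J}"
    and carM: "carrier ?M = {(x, \<phi> x \<oplus>\<^bsub>M2\<^esub> m) | x m. x \<in> carrier M1 \<and> m \<in> ideal_mult J M2}"
    by (simp_all add: amalg_ring_def amalg_module_def)
  have fc: "f r \<in> carrier R2" if "r \<in> carrier R1" for r
    using that assms(4) by blast
  have phc: "\<phi> x \<in> carrier M2" if "x \<in> carrier M1" for x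
    using that assms(9) by blast
  have JMc: "m \<in> carrier M2" if "m \<in> ideal_mult J M2" for m
    using that M2.submoduleE(1)[OF ideal_mult_submodule[OF assms(7,5)]] by blast
  have memS: "fst a \<in> carrier R1" "snd a \<in> carrier R2" if "a \<in> carrier ?S" for a
    using that fc J.Icarr by (auto simp: carS)
  have memM: "fst u \<in> carrier M1" "snd u \<in> carrier M2" if "u \<in> carrier ?M" for u
    using that phc JMc by (auto simp: carM)
  have liftS: "(r, f r) \<in> carrier ?S" if "r \<in> carrier R1" for r
    unfolding carS
    by (intro CollectI exI[of _ r] exI[of _ "\<zero>\<^bsub>R2\<^esub>"])
      (use that fc additive_subgroup.zero_closed[OF J.additive_subgroup_axioms] in simp)
  \<comment> \<open>As for \<open>liftS\<close>, the correction term is zero, which lies in the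
    submodule \<open>ideal_mult J M2\<close>.\<close>
  have liftM: "(x, \<phi> x) \<in> carrier ?M" if "x \<in> carrier M1" for x
    unfolding carM
    by (intro CollectI exI[of _ x] exI[of _ "\<zero>\<^bsub>M2\<^esub>"])
      (use that phc M2.submodule_zero_mem[OF ideal_mult_submodule[OF assms(7,5)]] in simp)
  have "module ?S ?M"
    by (rule amalg_module_module[OF assms(1-3,5-8)])
  moreover have "snd \<in> ring_hom ?S R2"
  proof (rule ring_hom_memI)
    show "snd a \<in> carrier R2" if "a \<in> carrier ?S" for a
      by (rule memS(2)[OF that])
    show "snd (a \<otimes>\<^bsub>?S\<^esub> b) = snd a \<otimes>\<^bsub>R2\<^esub> snd b" "snd (a \<oplus>\<^bsub>?S\<^esub> b) = snd a \<oplus>\<^bsub>R2\<^esub> snd b" for a b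
      by (cases a; cases b; simp add: amalg_ring_def RDirProd_def DirProd_def monoid.defs)+
    show "snd \<one>\<^bsub>?S\<^esub> = \<one>\<^bsub>R2\<^esub>"
      by (simp add: amalg_ring_def RDirProd_def DirProd_def monoid.defs)
  qed
  moreover have "snd ` carrier ?S = carrier R2"
  proof (intro equalityI subsetI)
    fix s assume "s \<in> carrier R2"
    then obtain r where "r \<in> carrier R1" "s = f r" using assms(4) by blast
    then show "s \<in> snd ` carrier ?S" using liftS by force
  qed (auto dest: memS(2))
  moreover have "snd \<in> mod_hom ?S ?M (restrict_scalars snd M2)"
  proof -
    have "snd (u \<oplus>\<^bsub>?M\<^esub> v) = snd u \<oplus>\<^bsub>M2\<^esub> snd v" for u v
      by (cases u; cases v) (simp add: amalg_module_def)
    \<comment> \<open>The four-term formula for the scalar product collapses to the componentwise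
      action by \<open>amalg_module_smult_pair\<close>.\<close>
    moreover have "snd (a \<odot>\<^bsub>?M\<^esub> u) = snd a \<odot>\<^bsub>M2\<^esub> snd u"
      if "a \<in> carrier ?S" "u \<in> carrier ?M" for a u
      using memS[OF that(1)] memM[OF that(2)] amalg_module_smult_pair[OF assms(1-3,6-8)]
      by (cases a; cases u) simp
    ultimately show ?thesis
      using memM(2) by (simp add: mod_hom_def restrict_scalars_def Pi_iff)
  qed
  moreover have "snd ` carrier ?M = carrier M2"
  proof (intro equalityI subsetI)
    fix y assume "y \<in> carrier M2"
    then obtain x where "x \<in> carrier M1" "y = \<phi> x" using assms(9) by blast
    then show "y \<in> snd ` carrier ?M" using liftM by force
  qed (auto dest: memM(2))
  ultimately show ?thesis
    using assms(7) by (simp add: semilinear_surj_def semilinear_surj_axioms_def)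
qed

theorem corollary5:
  fixes R1 :: "('a, 'k1) ring_scheme" and R2 :: "('b, 'k2) ring_scheme"
    and f :: "'a \<Rightarrow> 'b" and J :: "'b set"
    and M1 :: "('a, 'c, 'l1) module_scheme" and M2 :: "('b, 'd, 'l2) module_scheme"
    and \<phi> :: "'c \<Rightarrow> 'd" and N2 :: "'d set"
  assumes "cring R1" and "cring R2"
    and "f \<in> ring_hom R1 R2" and "f ` carrier R1 = carrier R2"
    and "ideal J R2"
    and "module R1 M1" and "module R2 M2"
    and "\<phi> \<in> mod_hom R1 M1 (restrict_scalars f M2)" and "\<phi> ` carrier M1 = carrier M2"
    and "submodule N2 R2 M2"
  shows "(primary_submodule (amalg_sub M1 M2 \<phi> J N2)
            (amalg_ring R1 R2 f J) (amalg_module M1 R2 M2 f \<phi> J)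
          \<longleftrightarrow> primary_submodule N2 R2 M2)
       \<and> (weakly_primary_submodule (amalg_sub M1 M2 \<phi> J N2)
            (amalg_ring R1 R2 f J) (amalg_module M1 R2 M2 f \<phi> J)
          \<longleftrightarrow> weakly_primary_submodule N2 R2 M2 \<and>
            (\<forall>r1 \<in> carrier R1. \<forall>m1 \<in> carrier M1. \<forall>m2 \<in> ideal_mult J M2. \<forall>j \<in> J.
               (f r1 \<oplus>\<^bsub>R2\<^esub> j) \<odot>\<^bsub>M2\<^esub> (\<phi> m1 \<oplus>\<^bsub>M2\<^esub> m2) = \<zero>\<^bsub>M2\<^esub> \<and>
               f r1 \<oplus>\<^bsub>R2\<^esub> j \<notin> radical R2 (residual N2 R2 M2) \<and>
               \<phi> m1 \<oplus>\<^bsub>M2\<^esub> m2 \<notin> N2 \<longrightarrow>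
               r1 \<odot>\<^bsub>M1\<^esub> m1 = \<zero>\<^bsub>M1\<^esub>))"
proof -
  interpret J: ideal J R2 by fact
  interpret M1: "module" R1 M1 by fact
  interpret M2: "module" R2 M2 by fact
  let ?S = "amalg_ring R1 R2 f J" and ?M = "amalg_module M1 R2 M2 f \<phi> J"
  interpret semilinear_surj ?S ?M R2 M2 snd snd
    by (rule amalg_snd_semilinear_surj[OF assms(1-9)])
  \<comment> \<open>The defining condition of \<open>amalg_sub\<close> constrains only the second
    component.\<close>
  have pre: "amalg_sub M1 M2 \<phi> J N2 = preimage N2"
    unfolding preimage_def by (auto simp: amalg_sub_def amalg_module_def)
  let ?bad = "\<lambda>s y. s \<odot>\<^bsub>M2\<^esub> y = \<zero>\<^bsub>M2\<^esub> \<and> s \<notin> radical R2 (residual N2 R2 M2) \<and> y \<notin> N2"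
  \<comment> \<open>The action is componentwise, so once the second component of the product
    vanishes, only the first decides whether the product is zero.\<close>
  have smult_zero_iff: "(r, s) \<odot>\<^bsub>?M\<^esub> (x, y) = \<zero>\<^bsub>?M\<^esub> \<longleftrightarrow> r \<odot>\<^bsub>M1\<^esub> x = \<zero>\<^bsub>M1\<^esub>"
    if "r \<in> carrier R1" "(r, s) \<in> carrier ?S" "x \<in> carrier M1" "(x, y) \<in> carrier ?M"
      "s \<odot>\<^bsub>M2\<^esub> y = \<zero>\<^bsub>M2\<^esub>" for r s x y
  proof -
    have "s \<in> carrier R2" "y \<in> carrier M2"
      using p.hom_closed[OF that(2)] q_closed[OF that(4)] by simp_all
    then have "(r, s) \<odot>\<^bsub>?M\<^esub> (x, y) = (r \<odot>\<^bsub>M1\<^esub> x, \<zero>\<^bsub>M2\<^esub>)"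
      using that amalg_module_smult_pair[OF assms(1-3,6-8)] by simp
    then show ?thesis
      by (simp add: amalg_module_def)
  qed
  \<comment> \<open>The kernel condition of \<open>weakly_primary_preimage_iff\<close> becomes the
    concrete one by writing \<open>a\<close> as \<open>(r1, f r1 + j)\<close> and \<open>u\<close>
    as \<open>(m1, \<phi> m1 + m2)\<close>; its conclusion shrinks to the first components.\<close>
  have "(\<forall>a \<in> carrier ?S. \<forall>u \<in> carrier ?M. ?bad (snd a) (snd u) \<longrightarrow> a \<odot>\<^bsub>?M\<^esub> u = \<zero>\<^bsub>?M\<^esub>) \<longleftrightarrow>
    (\<forall>r1 \<in> carrier R1. \<forall>m1 \<in> carrier M1. \<forall>m2 \<in> ideal_mult J M2. \<forall>j \<in> J.
       ?bad (f r1 \<oplus>\<^bsub>R2\<^esub> j) (\<phi> m1 \<oplus>\<^bsub>M2\<^esub> m2) \<longrightarrow> r1 \<odot>\<^bsub>M1\<^esub> m1 = \<zero>\<^bsub>M1\<^esub>)"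
    (is "?lhs \<longleftrightarrow> ?rhs")
  proof -
    have carS: "a \<in> carrier ?S \<longleftrightarrow> (\<exists>r j. a = (r, f r \<oplus>\<^bsub>R2\<^esub> j) \<and> r \<in> carrier R1 \<and> j \<in> J)"
      and carM: "u \<in> carrier ?M \<longleftrightarrow>
        (\<exists>x m. u = (x, \<phi> x \<oplus>\<^bsub>M2\<^esub> m) \<and> x \<in> carrier M1 \<and> m \<in> ideal_mult J M2)" for a u
      by (auto simp: amalg_ring_def amalg_module_def)
    have pair: "(r, f r \<oplus>\<^bsub>R2\<^esub> j) \<odot>\<^bsub>?M\<^esub> (x, \<phi> x \<oplus>\<^bsub>M2\<^esub> m) = \<zero>\<^bsub>?M\<^esub> \<longleftrightarrow> r \<odot>\<^bsub>M1\<^esub> x = \<zero>\<^bsub>M1\<^esub>"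
      if "r \<in> carrier R1" "j \<in> J" "x \<in> carrier M1" "m \<in> ideal_mult J M2"
        "(f r \<oplus>\<^bsub>R2\<^esub> j) \<odot>\<^bsub>M2\<^esub> (\<phi> x \<oplus>\<^bsub>M2\<^esub> m) = \<zero>\<^bsub>M2\<^esub>" for r j x m
      using that by (intro smult_zero_iff) (auto simp: carS carM)
    show ?thesis
    proof
      assume L: ?lhs
      show ?rhs
      proof (intro ballI impI)
        fix r x m j
        assume *: "r \<in> carrier R1" "x \<in> carrier M1" "m \<in> ideal_mult J M2" "j \<in> J"
          and bad: "?bad (f r \<oplus>\<^bsub>R2\<^esub> j) (\<phi> x \<oplus>\<^bsub>M2\<^esub> m)"
        have "(r, f r \<oplus>\<^bsub>R2\<^esub> j) \<in> carrier ?S" "(x, \<phi> x \<oplus>\<^bsub>M2\<^esub> m) \<in> carrier ?M"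
          using * by (auto simp: carS carM)
        with L bad have "(r, f r \<oplus>\<^bsub>R2\<^esub> j) \<odot>\<^bsub>?M\<^esub> (x, \<phi> x \<oplus>\<^bsub>M2\<^esub> m) = \<zero>\<^bsub>?M\<^esub>"
          by (metis snd_conv)
        then show "r \<odot>\<^bsub>M1\<^esub> x = \<zero>\<^bsub>M1\<^esub>" using pair * bad by blast
      qed
    next
      assume ?rhs
      then show ?lhs by (clarsimp simp: carS carM pair) blast
    qed
  qed
  then show ?thesis
    unfolding pre primary_preimage_iff[OF assms(10)] weakly_primary_preimage_iff[OF assms(10)]
    by blast
qed

end
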